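(* Let $0<\gamma<\bar\gamma<2$, and let $x^{k(j)},\dots,x^{k(j)+\eta+1}\in\mathcal X$ be generated by $x^{k+1}=P_{\mathcal X}(x^k-s^kg^k)$ for $k=k(j),\dots,k(j)+\eta$, where $g^k$ is a subgradient of $f$ at $x^k$, $s^k=\gamma\frac{f(x^k)-\bar f_k}{\|g^k\|^2}$, and the level values satisfy $\bar f_{k(j)}=\dots=\bar f_{k(j)+\eta}<f^\star$. If $x'$ is a feasible solution of the PSVD problem (decision vector $x\in\mathbb R^n$) $$(g^{\kappa})^\top x\le (g^{\kappa})^\top x^{\kappa}-\frac1{\bar\gamma}s^{\kappa}\|g^{\kappa}\|^2,\qquad \kappa=k(j),k(j)+1,\dots,k(j)+\eta,$$ then $x'$ is also feasible to the following constraint satisfaction problem with decision vector $x\in\mathbb R^n$: $$\|x-x^{\kappa+1}\|^2-\|x-x^{\kappa}\|^2\le\Big(1-\frac2{\bar\gamma}\Big)(s^{\kappa})^2\|g^{\kappa}\|^2,\qquad \kappa=k(j),k(j)+1,\dots,k(j)+\eta.$$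
   Context: $f:\mathbb R^n\to\mathbb R$ is convex (possibly non-smooth), $\mathcal X\subseteq\mathbb R^n$ is nonempty, closed and convex, $f^\star:=\inf_{x\in\mathcal X}f(x)>-\infty$, and $\mathcal X^\star:=\{x\in\mathcal X: f(x)=f^\star\}$ is nonempty. $P_{\mathcal X}$ is the Euclidean projection onto $\mathcal X$ and $\|\cdot\|$ the Euclidean norm. A subgradient of $f$ at $x^k$ is a vector $g^k$ with $f(x)\ge f(x^k)+(g^k)^\top(x-x^k)$ for all $x\in\mathcal X$. A level value $\bar f_k$ is a real number serving as an estimate of $f^\star$ at iteration $k$. The stepsize formula presupposes $g^k\neq0$. Here $k(j)$ and $\eta\ge0$ are integers.
   Formalization: The formal theorem additionally assumes that the PSVD-feasible point x' lies in 𝒳; for x' outside 𝒳 the claim fails, e.g. 𝒳=[0,∞), f(y)=y, γ=1/2, γ̄=1, x^k=1, g^k=1, level −3, x'=−1. *)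

theory Defs
  imports "HOL-Analysis.Analysis"
begin

text \<open>
  The Euclidean projection onto \<open>X\<close> is \<^const>\<open>closest_point\<close>: for a nonempty closed
  convex set the nearest point exists and is unique.
\<close>

text \<open>The subgradient inequality is required on \<open>X\<close> only, not on the whole space.\<close>

definition subgradient_on :: "('a::euclidean_space \<Rightarrow> real) \<Rightarrow> 'a set \<Rightarrow> 'a \<Rightarrow> 'a \<Rightarrow> bool" where
  "subgradient_on f X y v \<longleftrightarrow> (\<forall>z\<in>X. f z \<ge> f y + v \<bullet> (z - y))"

definition inf_value :: "('a::euclidean_space \<Rightarrow> real) \<Rightarrow> 'a set \<Rightarrow> real" where
  "inf_value f X = Inf (f ` X)"

definition minimizers :: "('a::euclidean_space \<Rightarrow> real) \<Rightarrow> 'a set \<Rightarrow> 'a set" where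
  "minimizers f X = {z \<in> X. f z = inf_value f X}"

definition polyak_step :: "real \<Rightarrow> ('a::euclidean_space \<Rightarrow> real) \<Rightarrow> real \<Rightarrow> 'a \<Rightarrow> 'a \<Rightarrow> real" where
  "polyak_step \<gamma> f level y v = \<gamma> * ((f y - level) / (norm v)\<^sup>2)"

text \<open>
  The two constraint systems, over an index range \<open>K\<close> of iterations. The decision vector \<open>z\<close> ranges
  over the whole space in both; neither system contains the constraint \<open>z \<in> X\<close>.
\<close>

definition PSVD_feasible ::
  "real \<Rightarrow> int set \<Rightarrow> (int \<Rightarrow> 'a::euclidean_space) \<Rightarrow> (int \<Rightarrow> 'a) \<Rightarrow> (int \<Rightarrow> real) \<Rightarrow> 'a \<Rightarrow> bool" where
  "PSVD_feasible \<gamma>' K x g s z \<longleftrightarrow>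
     (\<forall>\<kappa>\<in>K. g \<kappa> \<bullet> z \<le> g \<kappa> \<bullet> x \<kappa> - (1 / \<gamma>') * s \<kappa> * (norm (g \<kappa>))\<^sup>2)"

definition CSP_feasible ::
  "real \<Rightarrow> int set \<Rightarrow> (int \<Rightarrow> 'a::euclidean_space) \<Rightarrow> (int \<Rightarrow> 'a) \<Rightarrow> (int \<Rightarrow> real) \<Rightarrow> 'a \<Rightarrow> bool" where
  "CSP_feasible \<gamma>' K x g s z \<longleftrightarrow>
     (\<forall>\<kappa>\<in>K. (norm (z - x (\<kappa> + 1)))\<^sup>2 - (norm (z - x \<kappa>))\<^sup>2
              \<le> (1 - 2 / \<gamma>') * (s \<kappa>)\<^sup>2 * (norm (g \<kappa>))\<^sup>2)"

text \<open>
  Passing from PSVD to CSP feasibility uses that the projection onto \<open>X\<close> does not increase the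
  distance to \<open>z\<close>, which can fail for \<open>z \<notin> X\<close>, and then so can the implication: in dimension one
  take \<open>X = {0..}\<close>, \<open>f y = y\<close>, \<open>\<gamma> = 1/2\<close>, \<open>\<gamma>' = 1\<close>, a single iteration from \<open>x = 1\<close> with
  subgradient \<open>1\<close> and level \<open>-3\<close>, so that the step is \<open>2\<close> and the next iterate \<open>0\<close>. Then \<open>z = -1\<close>
  satisfies the PSVD constraint, but \<open>1 - 4 = -3\<close> exceeds the CSP bound \<open>-4\<close>. The implication is
  therefore claimed for PSVD-feasible points in \<open>X\<close>.
\<close>

end

theory Submission
  imports Defs
begin

text \<open>
  The two systems are compared constraint by constraint. Moving from \<open>y\<close> to \<open>y - t *\<^sub>R v\<close> changes
  the squared distance to a point \<open>z\<close> by \<open>2 * t * (v \<bullet> (z - y)) + t\<^sup>2 * (norm v)\<^sup>2\<close>, and the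
  projection that follows cannot increase it, because \<open>z\<close> lies in \<open>X\<close>. The constraint of PSVD
  says \<open>v \<bullet> (z - y) \<le> - (1 / \<gamma>') * t * (norm v)\<^sup>2\<close>. Multiplied by \<open>2 * t\<close>, it bounds the first
  term by \<open>- (2 / \<gamma>') * t\<^sup>2 * (norm v)\<^sup>2\<close>, and adding the second term gives the constraint of the
  other system. The multiplication requires \<open>t \<ge> 0\<close>, which holds for a Polyak step
  whose level underestimates the infimum (\<open>polyak_step_nonneg\<close>).
\<close>

lemma polyak_step_nonneg:
  assumes "bdd_below (f ` X)" "y \<in> X" "level \<le> inf_value f X" "0 \<le> \<gamma>"
  shows "0 \<le> polyak_step \<gamma> f level y v"
proof -
  have "inf_value f X \<le> f y"
    unfolding inf_value_def using assms(1,2) by (simp add: cINF_lower)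
  then show ?thesis
    unfolding polyak_step_def using assms(3,4) by simp
qed

text \<open>The projection is nonexpansive and fixes \<open>z\<close>, so projecting \<open>w\<close> cannot move it away
  from \<open>z\<close>.\<close>

lemma norm_diff_closest_point_le:
  fixes z :: "'a::euclidean_space"
  assumes "closed X" "convex X" "z \<in> X"
  shows "norm (z - closest_point X w) \<le> norm (z - w)"
proof -
  have "dist (closest_point X z) (closest_point X w) \<le> dist z w"
    using assms by (intro closest_point_lipschitz) auto
  then show ?thesis
    by (simp add: dist_norm closest_point_self[OF assms(3)])
qed

text \<open>
  One iteration. The parameter \<open>c\<close> stands for \<open>1 / \<gamma>'\<close>: if \<open>z\<close> lies beyond the cut, at fraction
  \<open>c\<close> of the step, the step makes progress towards \<open>z\<close> once \<open>c > 1 / 2\<close>, that is \<open>\<gamma>' < 2\<close>, and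
  \<open>t *\<^sub>R v \<noteq> 0\<close>.
\<close>

lemma projected_step_dist_sq_le:
  fixes z :: "'a::euclidean_space"
  assumes "closed X" "convex X" "z \<in> X" "0 \<le> t"
    and cut: "v \<bullet> z \<le> v \<bullet> y - c * t * (norm v)\<^sup>2"
  shows "(norm (z - closest_point X (y - t *\<^sub>R v)))\<^sup>2 - (norm (z - y))\<^sup>2
           \<le> (1 - 2 * c) * t\<^sup>2 * (norm v)\<^sup>2"
proof -
  have "(norm (z - closest_point X (y - t *\<^sub>R v)))\<^sup>2 \<le> (norm (z - (y - t *\<^sub>R v)))\<^sup>2"
    by (rule power_mono[OF norm_diff_closest_point_le[OF assms(1-3)] norm_ge_zero])
  moreover have "(norm (z - (y - t *\<^sub>R v)))\<^sup>2
      = (norm (z - y))\<^sup>2 + 2 * (t * (v \<bullet> (z - y))) + t\<^sup>2 * (norm v)\<^sup>2"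
  proof -
    have "z - (y - t *\<^sub>R v) = (z - y) + t *\<^sub>R v"
      by simp
    then show ?thesis
      by (simp only: power2_norm_eq_inner inner_add_left inner_add_right
          inner_scaleR_left inner_scaleR_right inner_commute[of "z - y" v])
        (simp only: power2_eq_square mult.assoc mult_2 add.assoc distrib_left)
  qed
  moreover have "t * (v \<bullet> (z - y)) \<le> t * (- (c * t * (norm v)\<^sup>2))"
    using cut \<open>0 \<le> t\<close> by (intro mult_left_mono) (simp_all add: inner_diff_right)
  moreover have "(1 - 2 * c) * t\<^sup>2 * (norm v)\<^sup>2
      = t\<^sup>2 * (norm v)\<^sup>2 + 2 * (t * (- (c * t * (norm v)\<^sup>2)))"
    by (simp add: algebra_simps power2_eq_square)
  ultimately show ?thesis
    by linarith
qed

theorem proposition2p4: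
  fixes f :: "real ^ 'n \<Rightarrow> real"
    and X :: "(real ^ 'n) set"
    and x g :: "int \<Rightarrow> real ^ 'n"
    and s level :: "int \<Rightarrow> real"
    and \<gamma> \<gamma>' :: real
    and kj \<eta> :: int
    and x' :: "real ^ 'n"
  assumes convex_f: "convex_on UNIV f"
    and X: "X \<noteq> {}" "closed X" "convex X"
    and bounded_below: "bdd_below (f ` X)"
    and attained: "minimizers f X \<noteq> {}"
    and gammas: "0 < \<gamma>" "\<gamma> < \<gamma>'" "\<gamma>' < 2"
    and eta: "0 \<le> \<eta>"
    and iterates_in: "\<forall>k\<in>{kj..kj + \<eta> + 1}. x k \<in> X"
    and subgradients: "\<forall>k\<in>{kj..kj + \<eta>}. subgradient_on f X (x k) (g k)"
    and nonzero: "\<forall>k\<in>{kj..kj + \<eta>}. g k \<noteq> 0"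
    and steps: "\<forall>k\<in>{kj..kj + \<eta>}. s k = polyak_step \<gamma> f (level k) (x k) (g k)"
    and iteration: "\<forall>k\<in>{kj..kj + \<eta>}. x (k + 1) = closest_point X (x k - s k *\<^sub>R g k)"
    and levels_const: "\<forall>k\<in>{kj..kj + \<eta>}. level k = level kj"
    and level_below: "level kj < inf_value f X"
    and x'_in: "x' \<in> X"
    and x'_PSVD: "PSVD_feasible \<gamma>' {kj..kj + \<eta>} x g s x'"
  shows "CSP_feasible \<gamma>' {kj..kj + \<eta>} x g s x'"
  unfolding CSP_feasible_def
proof
  fix k assume k: "k \<in> {kj..kj + \<eta>}"
  have "x k \<in> X"
    using iterates_in k by simp
  moreover have "level k \<le> inf_value f X"
    using bspec[OF levels_const k] level_below by linarith
  ultimately have "0 \<le> polyak_step \<gamma> f (level k) (x k) (g k)"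
    by (rule polyak_step_nonneg[OF bounded_below _ _ less_imp_le[OF gammas(1)]])
  then have "0 \<le> s k"
    using bspec[OF steps k] by simp
  moreover have "g k \<bullet> x' \<le> g k \<bullet> x k - (1 / \<gamma>') * s k * (norm (g k))\<^sup>2"
    using x'_PSVD k unfolding PSVD_feasible_def by blast
  ultimately show "(norm (x' - x (k + 1)))\<^sup>2 - (norm (x' - x k))\<^sup>2
      \<le> (1 - 2 / \<gamma>') * (s k)\<^sup>2 * (norm (g k))\<^sup>2"
    using projected_step_dist_sq_le[OF X(2,3) x'_in, of "s k" "g k" "x k" "1 / \<gamma>'"]
      bspec[OF iteration k] by simp
qed

end
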